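(* There exists a completely decomposable torsion-free abelian group that is Dedekind-finite but not Bassian-finite.
   Context: All groups are abelian, written additively. A group is completely decomposable if it is a direct sum of torsion-free groups of rank $1$. A group $G$ is Dedekind-finite if there is no isomorphism from $G$ to any proper direct summand of $G$ (a direct summand different from $G$). A group $G$ is Bassian-finite if there is no monomorphism from $G$ to any proper direct summand of $G$. *)

theory Defs
  imports "HOL-Algebra.Algebra" "HOL.Rat"
begin

text \<open>Abelian groups are \<^const>\<open>comm_group\<close>s. The library's group records use multiplicative
  notation, so a multiple \<open>n a\<close> is the power \<open>a [^] n\<close> and a finite sum is a \<^const>\<open>finprod\<close>.
  An existence claim needs a fixed carrier type; \<open>nat \<Rightarrow> rat\<close>, with an arbitrary carrier
  set and operation, accommodates every abelian group of at most continuum cardinality.\<close>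

definition torsion_free :: "('a, 'b) monoid_scheme \<Rightarrow> bool"
  where "torsion_free G \<longleftrightarrow>
    (\<forall>x \<in> carrier G. \<forall>n::nat. n > 0 \<longrightarrow> x [^]\<^bsub>G\<^esub> n = \<one>\<^bsub>G\<^esub> \<longrightarrow> x = \<one>\<^bsub>G\<^esub>)"

definition int_independent :: "('a, 'b) monoid_scheme \<Rightarrow> 'a set \<Rightarrow> bool"
  where "int_independent G B \<longleftrightarrow> B \<subseteq> carrier G \<and>
    (\<forall>F (c :: 'a \<Rightarrow> int). finite F \<longrightarrow> F \<subseteq> B \<longrightarrow>
       finprod G (\<lambda>b. b [^]\<^bsub>G\<^esub> c b) F = \<one>\<^bsub>G\<^esub> \<longrightarrow> (\<forall>b \<in> F. c b = 0))"

text \<open>Finite torsion-free rank: the size of a maximal independent subset. For torsion-free groups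
  this is the rank.\<close>

definition has_rank :: "('a, 'b) monoid_scheme \<Rightarrow> nat \<Rightarrow> bool"
  where "has_rank G n \<longleftrightarrow>
    (\<exists>B. int_independent G B \<and> (\<forall>B'. int_independent G B' \<longrightarrow> B \<subseteq> B' \<longrightarrow> B' = B) \<and>
         finite B \<and> card B = n)"

text \<open>\<^const>\<open>gfinprod\<close> is used because \<^const>\<open>finprod\<close> over an infinite index set is
  trivial, even for finitely supported families.\<close>

definition internal_direct_sum :: "('a, 'b) monoid_scheme \<Rightarrow> 'a set set \<Rightarrow> bool"
  where "internal_direct_sum G \<H> \<longleftrightarrow> (\<forall>H \<in> \<H>. subgroup H G) \<and>
    (\<lambda>x. gfinprod G x \<H>) \<in> iso (sum_group \<H> (\<lambda>H. G\<lparr>carrier := H\<rparr>)) G"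

text \<open>A family of subgroups can be given as a set of subgroups without loss of generality:
  rank-1 summands are nontrivial, so those with different indices are distinct.\<close>

definition completely_decomposable :: "('a, 'b) monoid_scheme \<Rightarrow> bool"
  where "completely_decomposable G \<longleftrightarrow>
    (\<exists>\<H>. internal_direct_sum G \<H> \<and>
      (\<forall>H \<in> \<H>. torsion_free (G\<lparr>carrier := H\<rparr>) \<and> has_rank (G\<lparr>carrier := H\<rparr>) 1))"

definition direct_summand :: "'a set \<Rightarrow> ('a, 'b) monoid_scheme \<Rightarrow> bool"
  where "direct_summand H G \<longleftrightarrow> subgroup H G \<and>
    (\<exists>K. subgroup K G \<and> H \<inter> K = {\<one>\<^bsub>G\<^esub>} \<and> H <#>\<^bsub>G\<^esub> K = carrier G)"

definition Dedekind_finite :: "('a, 'b) monoid_scheme \<Rightarrow> bool"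
  where "Dedekind_finite G \<longleftrightarrow>
    \<not> (\<exists>H. direct_summand H G \<and> H \<noteq> carrier G \<and> G \<cong> G\<lparr>carrier := H\<rparr>)"

definition Bassian_finite :: "('a, 'b) monoid_scheme \<Rightarrow> bool"
  where "Bassian_finite G \<longleftrightarrow>
    \<not> (\<exists>H. direct_summand H G \<and> H \<noteq> carrier G \<and> mon G (G\<lparr>carrier := H\<rparr>) \<noteq> {})"

end

theory Submission
  imports Defs
begin

text \<open>Let \<open>P 0 = 1\<close>, \<open>P (n + 1) = P n (P n + 1)\<close>, and let \<open>G\<close> be the direct sum of the groups
  \<open>R n = \<int>[1 / P n]\<close>. These increase with \<open>n\<close>, so the shift embeds \<open>G\<close> into the proper summand
  \<open>R 1 + R 2 + ...\<close>. Since \<open>P n + 1\<close> is coprime to \<open>P n\<close> and is inverted in \<open>R (n + 1)\<close>, there is no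
  nonzero map from \<open>R m\<close> to \<open>R n\<close> for \<open>n < m\<close>. Hence endomorphisms of \<open>G\<close> are triangular, and a
  surjective one has nonzero diagonal entries, so it is injective: \<open>G\<close> is Hopfian and therefore Dedekind-finite.\<close>

section \<open>Direct sums of subgroups of the rationals, computed coordinatewise\<close>

text \<open>Taking elements to be finitely supported sequences keeps the group inside the carrier
  type \<open>nat \<Rightarrow> rat\<close>. The definition accepts any family of sets; the locale
  below adds the closure conditions that make it a group.\<close>

definition rat_direct_sum :: "(nat \<Rightarrow> rat set) \<Rightarrow> (nat \<Rightarrow> rat) monoid"
  where "rat_direct_sum R =
    \<lparr>carrier = {x. finite {i. x i \<noteq> 0} \<and> (\<forall>i. x i \<in> R i)},
     monoid.mult = (\<lambda>x y i. x i + y i), one = (\<lambda>_. 0)\<rparr>"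

locale rat_subgroups =
  fixes R :: "nat \<Rightarrow> rat set"
  assumes zero_mem: "0 \<in> R n"
    and add_mem: "a \<in> R n \<Longrightarrow> b \<in> R n \<Longrightarrow> a + b \<in> R n"
    and minus_mem: "a \<in> R n \<Longrightarrow> - a \<in> R n"
begin

abbreviation G where "G \<equiv> rat_direct_sum R"

lemma mem_G: "x \<in> carrier G \<longleftrightarrow> finite {i. x i \<noteq> 0} \<and> (\<forall>i. x i \<in> R i)"
  by (simp add: rat_direct_sum_def)

lemma mult_G: "x \<otimes>\<^bsub>G\<^esub> y = (\<lambda>i. x i + y i)"
  by (simp add: rat_direct_sum_def)

lemma one_G: "\<one>\<^bsub>G\<^esub> = (\<lambda>_. 0)"
  by (simp add: rat_direct_sum_def)

lemma add_closed:
  assumes "x \<in> carrier G" "y \<in> carrier G"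
  shows "(\<lambda>i. x i + y i) \<in> carrier G"
proof -
  have "{i. x i + y i \<noteq> 0} \<subseteq> {i. x i \<noteq> 0} \<union> {i. y i \<noteq> 0}"
    by auto
  moreover have "finite ({i. x i \<noteq> 0} \<union> {i. y i \<noteq> 0})"
    using assms by (simp add: mem_G)
  ultimately have "finite {i. x i + y i \<noteq> 0}"
    by (rule finite_subset)
  then show ?thesis
    using assms by (simp add: mem_G add_mem)
qed

lemma minus_closed: "x \<in> carrier G \<Longrightarrow> (\<lambda>i. - x i) \<in> carrier G"
  by (simp add: mem_G minus_mem)

sublocale comm_group G
proof (rule comm_groupI)
  fix x assume "x \<in> carrier G"
  then show "\<exists>y\<in>carrier G. y \<otimes>\<^bsub>G\<^esub> x = \<one>\<^bsub>G\<^esub>"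
    by (intro bexI[of _ "\<lambda>i. - x i"]) (simp_all add: mult_G one_G minus_closed)
next
  show "\<one>\<^bsub>G\<^esub> \<in> carrier G"
    by (simp add: mem_G one_G zero_mem)
qed (simp_all add: mult_G one_G add_closed ac_simps)

lemma inv_coord: "x \<in> carrier G \<Longrightarrow> inv\<^bsub>G\<^esub> x = (\<lambda>i. - x i)"
  by (rule inv_equality) (simp_all add: mult_G one_G minus_closed)

lemma nat_pow_coord: "x [^]\<^bsub>G\<^esub> (n::nat) = (\<lambda>i. of_nat n * x i)"
  by (induction n) (simp_all add: mult_G one_G algebra_simps)

lemma int_pow_coord:
  assumes "x \<in> carrier G"
  shows "x [^]\<^bsub>G\<^esub> (c::int) = (\<lambda>i. of_int c * x i)"
proof (cases "c < 0")
  case True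
  then have "x [^]\<^bsub>G\<^esub> c = inv\<^bsub>G\<^esub> (x [^]\<^bsub>G\<^esub> nat (- c))"
    by (simp only: int_pow_def2 if_True)
  also have "\<dots> = (\<lambda>i. - (x [^]\<^bsub>G\<^esub> nat (- c)) i)"
    by (rule inv_coord) (rule nat_pow_closed[OF assms])
  also have "\<dots> = (\<lambda>i. of_int c * x i)"
    using True by (simp add: nat_pow_coord)
  finally show ?thesis .
next
  case False
  then have "x [^]\<^bsub>G\<^esub> c = x [^]\<^bsub>G\<^esub> nat c"
    by (simp only: int_pow_def2 if_False)
  also have "\<dots> = (\<lambda>i. of_int c * x i)"
    using False by (simp add: nat_pow_coord)
  finally show ?thesis .
qed

lemma torsion_free_G: "torsion_free G"
  by (auto simp: torsion_free_def nat_pow_coord one_G fun_eq_iff)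

lemma scale_closed: "x \<in> carrier G \<Longrightarrow> (\<lambda>i. of_int c * x i) \<in> carrier G"
  using int_pow_closed[of x c] by (simp add: int_pow_coord)

lemma hom_scale:
  assumes "f \<in> hom G G" "x \<in> carrier G"
  shows "f (\<lambda>i. of_int c * x i) = (\<lambda>i. of_int c * f x i)"
proof -
  interpret group_hom G G f
    using assms(1) by unfold_locales
  show ?thesis
    using hom_int_pow[of x c] assms(2) by (simp add: int_pow_coord)
qed

lemma unit_closed: "q \<in> R n \<Longrightarrow> (\<lambda>i. if i = n then q else 0) \<in> carrier G"
  by (auto simp: mem_G zero_mem)

section \<open>Coordinate lines and the internal decomposition\<close>

definition line :: "nat \<Rightarrow> (nat \<Rightarrow> rat) set"
  where "line n = {x \<in> carrier G. \<forall>i. i \<noteq> n \<longrightarrow> x i = 0}"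

lemma unit_mem_line: "q \<in> R n \<Longrightarrow> (\<lambda>i. if i = n then q else 0) \<in> line n"
  by (simp add: line_def unit_closed)

lemma line_subgroup: "subgroup (line n) G"
proof (rule subgroupI)
  show "line n \<noteq> {}"
    using unit_mem_line[OF zero_mem] by auto
qed (auto simp: line_def inv_coord minus_closed mult_G add_closed)

text \<open>A line is again a direct sum of the same shape, with all other coordinates trivial. This
  lets facts about \<open>rat_direct_sum\<close>, such as torsion-freeness and the rank computation,
  be applied to the summands.\<close>

lemma line_carrier: "G\<lparr>carrier := line n\<rparr> = rat_direct_sum (\<lambda>i. if i = n then R n else {0})"
proof -
  have "x i \<in> (if i = n then R n else {0}) \<longleftrightarrow> x i \<in> R i \<and> (i \<noteq> n \<longrightarrow> x i = 0)" for x i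
    by (auto simp: zero_mem)
  then have "x \<in> line n \<longleftrightarrow> x \<in> carrier (rat_direct_sum (\<lambda>i. if i = n then R n else {0}))" for x
    by (simp add: line_def rat_direct_sum_def all_conj_distrib)
  then have "line n = carrier (rat_direct_sum (\<lambda>i. if i = n then R n else {0}))"
    by blast
  then show ?thesis
    by (simp add: rat_direct_sum_def)
qed

text \<open>The unit vector at \<open>m\<close> lies in \<open>line m\<close> only. Injectivity
  matters because the decomposition is indexed by the subgroups themselves and not by
  numbers.\<close>

lemma inj_line:
  assumes "\<And>n. 1 \<in> R n"
  shows "inj line"
proof (rule injI, rule ccontr)
  fix m n assume "line m = line n" "m \<noteq> n"
  then show False
    using unit_mem_line[OF assms, of m] by (auto simp: line_def)
qed

text \<open>Group sums are taken coordinatewise, and among all lines only \<open>line i\<close> can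
  contribute to coordinate \<open>i\<close>.\<close>

lemma gfinprod_lines:
  assumes R1: "\<And>n. 1 \<in> R n"
    and fin: "finite {H \<in> range line. u H \<noteq> \<one>\<^bsub>G\<^esub>}"
    and u: "\<And>n. u (line n) \<in> line n"
  shows "gfinprod G u (range line) i = u (line i) i"
proof -
  let ?S = "{H \<in> range line. u H \<noteq> \<one>\<^bsub>G\<^esub>}"
  have "finprod G u F i = (\<Sum>H\<in>F. u H i)" if "finite F" "F \<subseteq> range line" for F
    using that
  proof (induction F)
    case (insert H F)
    have "u K \<in> carrier G" if "K \<in> range line" for K
      using u that by (auto simp: line_def)
    with insert show ?case
      by (subst finprod_insert) (auto simp: mult_G)
  qed (simp add: one_G)
  then have "gfinprod G u (range line) i = (\<Sum>H\<in>?S. u H i)"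
    using fin by (auto simp: gfinprod_def)
  also have "\<dots> = (\<Sum>H\<in>?S. if H = line i then u (line i) i else 0)"
  proof (intro sum.cong refl)
    fix H assume "H \<in> ?S"
    then obtain n where "H = line n" by auto
    then show "u H i = (if H = line i then u (line i) i else 0)"
      using u[of n] by (cases "n = i") (auto simp: line_def)
  qed
  \<comment> \<open>If \<open>line i\<close> lies outside the support, the sum is 0, and so is
    \<open>u (line i) i\<close>, since \<open>u (line i)\<close> is then the zero sequence.\<close>
  also have "\<dots> = u (line i) i"
    using fin by (auto simp: one_G)
  finally show ?thesis .
qed

text \<open>By \<open>gfinprod_lines\<close> the sum map reads off the \<open>i\<close>-th
  coordinate of the component in \<open>line i\<close>. An element of a line is determined by that
  single coordinate, so the map is bijective.\<close>

lemma internal_direct_sum_lines: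
  assumes R1: "\<And>n. 1 \<in> R n"
  shows "internal_direct_sum G (range line)"
  unfolding internal_direct_sum_def
proof (intro conjI ballI)
  show "subgroup H G" if "H \<in> range line" for H
    using that line_subgroup by auto
  let ?A = "\<lambda>H. G\<lparr>carrier := H\<rparr>"
  let ?S = "sum_group (range line) ?A"
  let ?f = "\<lambda>u. gfinprod G u (range line)"
  have grp: "group (?A H)" if "H \<in> range line" for H
    using that line_subgroup by (auto intro: subgroup.subgroup_is_group)
  have carr: "carrier ?S = {u \<in> Pi\<^sub>E (range line) (\<lambda>H. H). finite {H \<in> range line. u H \<noteq> \<one>\<^bsub>G\<^esub>}}"
    using carrier_sum_group[of "range line" ?A] grp by simp
  have coord: "?f u i = u (line i) i" if "u \<in> carrier ?S" for u i
    using that carr by (intro gfinprod_lines) (auto simp: R1)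
  show "?f \<in> iso ?S G"
  proof (rule isoI)
    have "(\<lambda>x. x) \<in> hom (?A H) G" if "H \<in> range line" for H
      using that by (auto simp: hom_def line_def)
    from hom_group_sum[OF this grp] show "?f \<in> hom ?S G"
      by simp
    have "inj_on ?f (carrier ?S)"
    proof (rule inj_onI)
      fix u v assume XY: "u \<in> carrier ?S" "v \<in> carrier ?S" "?f u = ?f v"
      have "u (line n) i = v (line n) i" for n i
      proof (cases "i = n")
        case True
        then show ?thesis
          using XY coord by metis
      next
        case False
        have "u (line n) \<in> line n" "v (line n) \<in> line n"
          using XY carr by auto
        then show ?thesis
          using False by (simp add: line_def)
      qed
      then show "u = v"
        using XY(1,2) carr by (intro PiE_ext[of u "range line" "\<lambda>H. H" v]) auto
    qed
    moreover have "?f ` carrier ?S = carrier G"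
    proof (intro equalityI subsetI)
      fix y assume "y \<in> ?f ` carrier ?S"
      then show "y \<in> carrier G"
        using \<open>?f \<in> hom ?S G\<close> by (auto simp: hom_def)
    next
      fix y assume y: "y \<in> carrier G"
      \<comment> \<open>The preimage splits \<open>y\<close> into its coordinates. The test
        \<open>H = line i\<close> recovers the index from the subgroup, which is unambiguous by
        \<open>inj_line\<close>.\<close>
      define u where "u = (\<lambda>H\<in>range line. \<lambda>i. if H = line i then y i else 0)"
      have u_line: "u (line n) = (\<lambda>i. if i = n then y n else 0)" for n
        using inj_line[OF R1] by (auto simp: u_def inj_eq fun_eq_iff)
      have "u \<in> Pi\<^sub>E (range line) (\<lambda>H. H)"
      proof (rule PiE_I)
        show "u H \<in> H" if "H \<in> range line" for H
          using that y by (auto simp: u_line unit_mem_line mem_G)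
      qed (simp add: u_def)
      moreover have "{H \<in> range line. u H \<noteq> \<one>\<^bsub>G\<^esub>} \<subseteq> line ` {i. y i \<noteq> 0}"
        by (auto simp: u_line one_G fun_eq_iff split: if_splits)
      then have "finite {H \<in> range line. u H \<noteq> \<one>\<^bsub>G\<^esub>}"
        using y by (simp add: mem_G finite_subset)
      ultimately have u: "u \<in> carrier ?S"
        by (simp add: carr)
      then have "?f u = y"
        by (auto simp: coord u_line)
      with u show "y \<in> ?f ` carrier ?S"
        by blast
    qed
    ultimately show "bij_betw ?f (carrier ?S) (carrier G)"
      by (simp add: bij_betw_def)
  qed
qed

end

section \<open>Rank one and complete decomposability\<close>

text \<open>The unit vector \<open>e\<close> is a maximal independent set: any other
  \<open>b\<close> is the rational multiple \<open>k / d\<close> of \<open>e\<close>, which gives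
  the integral relation \<open>d b - k e = 0\<close> with \<open>d > 0\<close>.\<close>

lemma has_rank_one_concentrated:
  assumes "rat_subgroups R" and R1: "1 \<in> R n" and R0: "\<And>i. i \<noteq> n \<Longrightarrow> R i = {0}"
  shows "has_rank (rat_direct_sum R) 1"
proof -
  interpret rat_subgroups R by fact
  define e where "e = (\<lambda>i. if i = n then 1 else 0 :: rat)"
  have e: "e \<in> carrier G"
    using R1 by (simp add: e_def unit_closed)
  have conc: "x i = 0" if "x \<in> carrier G" "i \<noteq> n" for x i
    using that R0 by (auto simp: mem_G)
  have independent: "int_independent G {e}"
    unfolding int_independent_def
  proof (intro conjI allI impI)
    fix F c assume F: "finite F" "F \<subseteq> {e}"
      "finprod G (\<lambda>b. b [^]\<^bsub>G\<^esub> (c b::int)) F = \<one>\<^bsub>G\<^esub>"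
    then consider "F = {}" | "F = {e}" by auto
    then show "\<forall>b\<in>F. c b = 0"
    proof cases
      case 2
      then have "e [^]\<^bsub>G\<^esub> c e = \<one>\<^bsub>G\<^esub>"
        using F e by simp
      then have "(e [^]\<^bsub>G\<^esub> c e) n = 0"
        by (simp add: one_G)
      then have "of_int (c e) * e n = 0"
        by (simp add: int_pow_coord[OF e])
      with 2 show ?thesis
        by (simp add: e_def)
    qed simp
  qed (use e in simp)
  have maximal: "B = {e}" if B: "int_independent G B" "{e} \<subseteq> B" for B
  proof (rule ccontr)
    assume "B \<noteq> {e}"
    then obtain b where b: "b \<in> B" "b \<noteq> e"
      using B by auto
    then have bG: "b \<in> carrier G"
      using B by (auto simp: int_independent_def)
    obtain k d where kd: "d > 0" "b n = of_int k / of_int d"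
      by (metis quotient_of_div quotient_of_denom_pos surj_pair)
    define c where "c x = (if x = b then d else - k)" for x
    have "finprod G (\<lambda>x. x [^]\<^bsub>G\<^esub> c x) {e, b} = e [^]\<^bsub>G\<^esub> c e \<otimes>\<^bsub>G\<^esub> b [^]\<^bsub>G\<^esub> c b"
      using e bG b by simp
    also have "\<dots> = \<one>\<^bsub>G\<^esub>"
    proof
      fix i
      show "(e [^]\<^bsub>G\<^esub> c e \<otimes>\<^bsub>G\<^esub> b [^]\<^bsub>G\<^esub> c b) i = \<one>\<^bsub>G\<^esub> i"
        using e bG b kd conc[OF bG, of i]
        by (cases "i = n") (auto simp: int_pow_coord mult_G one_G c_def e_def)
    qed
    finally have "finprod G (\<lambda>x. x [^]\<^bsub>G\<^esub> c x) {e, b} = \<one>\<^bsub>G\<^esub>" .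
    moreover have "finite {e, b}" "{e, b} \<subseteq> B"
      using B(2) b(1) by auto
    ultimately have "c b = 0"
      using B(1) unfolding int_independent_def by blast
    then show False
      using kd(1) by (simp add: c_def)
  qed
  show ?thesis
    unfolding has_rank_def
  proof (intro exI[of _ "{e}"] conjI allI impI)
    show "B = {e}" if "int_independent G B" "{e} \<subseteq> B" for B
      using that by (rule maximal)
  qed (simp_all add: independent)
qed

lemma (in rat_subgroups) completely_decomposable_G:
  assumes "\<And>n. 1 \<in> R n"
  shows "completely_decomposable G"
  unfolding completely_decomposable_def
proof (intro exI conjI ballI)
  show "internal_direct_sum G (range line)"
    using assms by (rule internal_direct_sum_lines)
  fix H assume "H \<in> range line"
  then obtain n where H: "H = line n" by auto
  have "rat_subgroups (\<lambda>i. if i = n then R n else {0})"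
    by unfold_locales (auto simp: zero_mem add_mem minus_mem)
  then show "torsion_free (G\<lparr>carrier := H\<rparr>)" "has_rank (G\<lparr>carrier := H\<rparr>) 1"
    unfolding H line_carrier
    using rat_subgroups.torsion_free_G has_rank_one_concentrated[of _ n] assms by auto
qed

section \<open>Hopfian groups are Dedekind-finite\<close>

lemma (in comm_group) direct_summand_projection:
  assumes H: "subgroup H G" and K: "subgroup K G" and HK: "H \<inter> K = {\<one>}" "H <#> K = carrier G"
  obtains p where "p \<in> hom G (G\<lparr>carrier := H\<rparr>)" "\<And>h. h \<in> H \<Longrightarrow> p h = h" "\<And>k. k \<in> K \<Longrightarrow> p k = \<one>"
proof -
  interpret H: subgroup H G by fact
  interpret K: subgroup K G by fact
  have "\<forall>x\<in>carrier G. \<exists>h\<in>H. \<exists>k\<in>K. x = h \<otimes> k"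
    unfolding HK(2)[symmetric] by (auto simp: set_mult_def)
  then obtain p q where pq: "\<And>x. x \<in> carrier G \<Longrightarrow> p x \<in> H \<and> q x \<in> K \<and> x = p x \<otimes> q x"
    by metis
  have uniq: "p (h \<otimes> k) = h" if hk: "h \<in> H" "k \<in> K" for h k
  proof -
    define a b where "a = p (h \<otimes> k)" and "b = q (h \<otimes> k)"
    have ab: "a \<in> H" "b \<in> K" "h \<otimes> k = a \<otimes> b"
      using pq[of "h \<otimes> k"] hk by (auto simp: a_def b_def)
    \<comment> \<open>Two decompositions \<open>h + k = a + b\<close> give
      \<open>h - a = b - k\<close>, an element of both \<open>H\<close> and \<open>K\<close>, hence
      zero.\<close>
    have "inv a \<otimes> h = inv a \<otimes> (h \<otimes> k) \<otimes> inv k"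
      using hk ab(1) by (simp add: m_assoc)
    also have "\<dots> = inv a \<otimes> (a \<otimes> b) \<otimes> inv k"
      by (simp only: ab(3))
    also have "\<dots> = b \<otimes> inv k"
      using hk ab(1,2) by (simp flip: m_assoc)
    finally have "inv a \<otimes> h \<in> K"
      using hk(2) ab(2) by (simp only: K.m_closed K.m_inv_closed)
    moreover have "inv a \<otimes> h \<in> H"
      using hk(1) ab(1) by simp
    ultimately have "inv a \<otimes> h = \<one>"
      using HK(1) by blast
    then have "inv h = inv a"
      using hk ab(1) by (intro inv_equality) simp_all
    then have "inv (inv h) = inv (inv a)"
      by simp
    then show ?thesis
      using hk ab(1) by (simp add: a_def)
  qed
  show ?thesis
  proof
    show "p \<in> hom G (G\<lparr>carrier := H\<rparr>)"
    proof (rule homI)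
      fix x y assume xy: "x \<in> carrier G" "y \<in> carrier G"
      have mem: "p x \<in> H" "q x \<in> K" "p y \<in> H" "q y \<in> K"
        using pq xy by auto
      have "x \<otimes> y = (p x \<otimes> q x) \<otimes> (p y \<otimes> q y)"
        using pq xy by simp
      also have "\<dots> = (p x \<otimes> p y) \<otimes> (q x \<otimes> q y)"
        using mem by (simp add: m_ac)
      \<comment> \<open>Additivity follows from uniqueness of the decomposition, applied to the
        regrouped sum.\<close>
      finally show "p (x \<otimes> y) = p x \<otimes>\<^bsub>G\<lparr>carrier := H\<rparr>\<^esub> p y"
        using uniq[of "p x \<otimes> p y" "q x \<otimes> q y"] mem by simp
    qed (use pq in simp)
    show "p h = h" if "h \<in> H" for h
      using uniq[of h \<one>] that by simp
    show "p k = \<one>" if "k \<in> K" for k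
      using uniq[of \<one> k] that by simp
  qed
qed

text \<open>Following the projection onto \<open>H\<close> by the inverse of the isomorphism from
  \<open>G\<close> to \<open>H\<close> gives a surjective endomorphism of \<open>G\<close> that
  kills the complement \<open>K\<close>. If it is injective, then \<open>K\<close> is trivial and
  \<open>H\<close> is all of \<open>G\<close>.\<close>

lemma (in comm_group) Hopfian_imp_Dedekind_finite:
  assumes Hopf: "\<And>f. f \<in> hom G G \<Longrightarrow> f ` carrier G = carrier G \<Longrightarrow> inj_on f (carrier G)"
  shows "Dedekind_finite G"
  unfolding Dedekind_finite_def
proof
  assume "\<exists>H. direct_summand H G \<and> H \<noteq> carrier G \<and> G \<cong> G\<lparr>carrier := H\<rparr>"
  then obtain H K where H: "subgroup H G" "H \<noteq> carrier G" "G \<cong> G\<lparr>carrier := H\<rparr>"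
    and K: "subgroup K G" "H \<inter> K = {\<one>}" "H <#> K = carrier G"
    by (auto simp: direct_summand_def)
  obtain p where p: "p \<in> hom G (G\<lparr>carrier := H\<rparr>)" "\<And>h. h \<in> H \<Longrightarrow> p h = h" "\<And>k. k \<in> K \<Longrightarrow> p k = \<one>"
    using direct_summand_projection[OF H(1) K] by blast
  obtain g where g: "g \<in> iso (G\<lparr>carrier := H\<rparr>) G"
    using iso_sym[OF H(3)] by (auto simp: is_iso_def)
  then have g_hom: "g \<in> hom (G\<lparr>carrier := H\<rparr>) G" and g_img: "g ` H = carrier G"
    by (auto simp: iso_def bij_betw_def)
  have HG: "H \<subseteq> carrier G" and KG: "K \<subseteq> carrier G"
    using H(1) K(1) by (auto dest: subgroup.subset)
  have "p ` carrier G = H"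
  proof
    show "p ` carrier G \<subseteq> H"
      using hom_carrier[OF p(1)] by simp
    show "H \<subseteq> p ` carrier G"
    proof
      fix h assume "h \<in> H"
      then show "h \<in> p ` carrier G"
        using p(2)[of h] HG by (intro image_eqI[of _ _ h]) auto
    qed
  qed
  then have "(g \<circ> p) ` carrier G = carrier G"
    using g_img by (simp only: image_comp[symmetric])
  moreover have "g \<circ> p \<in> hom G G"
    using p(1) g_hom by (auto simp: hom_def Pi_iff)
  ultimately have inj: "inj_on (g \<circ> p) (carrier G)"
    by (rule Hopf[rotated])
  have "K \<subseteq> {\<one>}"
  proof
    fix k assume k: "k \<in> K"
    have "\<one> \<in> K"
      using K(1) by (rule subgroup.one_closed)
    then have eq: "(g \<circ> p) k = (g \<circ> p) \<one>"
      using k p(3) by simp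
    then show "k \<in> {\<one>}"
      using inj_onD[OF inj eq] k KG by auto
  qed
  then have "carrier G \<subseteq> H"
    using K(3) HG by (force simp: set_mult_def)
  then show False
    using H(2) HG by auto
qed

section \<open>The rings obtained from the integers by inverting the \<open>sylvester\<close>
  numbers\<close>

text \<open>Sylvester's sequence 2, 3, 7, 43, ... is \<open>sylvester n + 1\<close>; the value
  \<open>sylvester n\<close> itself is the product of the first \<open>n\<close> terms of that
  sequence.\<close>

fun sylvester :: "nat \<Rightarrow> int"
  where "sylvester 0 = 1"
  | "sylvester (Suc n) = sylvester n * (sylvester n + 1)"

lemma sylvester_pos: "sylvester n > 0"
  by (induction n) auto

lemma sylvester_dvd: "m \<le> n \<Longrightarrow> sylvester m dvd sylvester n"
  by (induction n rule: dec_induct) auto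

text \<open>The recursion makes \<open>sylvester m + 1\<close> a factor of
  \<open>sylvester (Suc m)\<close>, which divides all later values. So every summand after the
  \<open>m\<close>-th inverts this number.\<close>

lemma Suc_sylvester_dvd: "m < n \<Longrightarrow> sylvester m + 1 dvd sylvester n"
  using sylvester_dvd[of "Suc m" n] by (auto dest: dvd_mult_right)

text \<open>The ring \<open>\<int>[1 / sylvester n]\<close>, described by clearing
  denominators.\<close>

definition sylvester_loc :: "nat \<Rightarrow> rat set"
  where "sylvester_loc n = {q. \<exists>k. q * of_int (sylvester n) ^ k \<in> \<int>}"

lemma Ints_mult_sylvester_power:
  assumes "q * of_int (sylvester n) ^ k \<in> \<int>" "k \<le> l"
  shows "q * of_int (sylvester n) ^ l \<in> \<int>"
proof -
  have "q * of_int (sylvester n) ^ l = q * of_int (sylvester n) ^ k * of_int (sylvester n ^ (l - k))"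
    using assms(2) by (simp add: mult.assoc flip: power_add)
  then show ?thesis
    using assms(1) Ints_mult Ints_of_int by metis
qed

lemma Ints_sylvester_loc: "q \<in> \<int> \<Longrightarrow> q \<in> sylvester_loc n"
  by (auto simp: sylvester_loc_def intro: exI[of _ 0])

lemma add_sylvester_loc:
  assumes "a \<in> sylvester_loc n" "b \<in> sylvester_loc n"
  shows "a + b \<in> sylvester_loc n"
proof -
  obtain k l where "a * of_int (sylvester n) ^ k \<in> \<int>" "b * of_int (sylvester n) ^ l \<in> \<int>"
    using assms by (auto simp: sylvester_loc_def)
  then have "a * of_int (sylvester n) ^ max k l \<in> \<int>" "b * of_int (sylvester n) ^ max k l \<in> \<int>"
    by (auto intro: Ints_mult_sylvester_power)
  then show ?thesis
    by (auto simp: sylvester_loc_def distrib_right intro: exI[of _ "max k l"])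
qed

text \<open>The same exponent clears the denominator, because \<open>sylvester m\<close> divides
  \<open>sylvester n\<close>. These inclusions make the shift a map into the group.\<close>

lemma sylvester_loc_mono:
  assumes "m \<le> n"
  shows "sylvester_loc m \<subseteq> sylvester_loc n"
proof
  fix q assume "q \<in> sylvester_loc m"
  then obtain k where k: "q * of_int (sylvester m) ^ k \<in> \<int>"
    by (auto simp: sylvester_loc_def)
  obtain t where "sylvester n = sylvester m * t"
    using sylvester_dvd[OF assms] by (elim dvdE)
  then have "q * of_int (sylvester n) ^ k = q * of_int (sylvester m) ^ k * of_int (t ^ k)"
    by (simp add: power_mult_distrib)
  then show "q \<in> sylvester_loc n"
    using k Ints_mult Ints_of_int unfolding sylvester_loc_def by (metis mem_Collect_eq)
qed

text \<open>A divisor \<open>d\<close> of \<open>sylvester n\<close> is a unit of the ring: with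
  \<open>sylvester n = d * t\<close>, raising the clearing exponent by \<open>k\<close> cancels
  \<open>d ^ k\<close> and leaves the integer \<open>t ^ k\<close>.\<close>

lemma divide_power_sylvester_loc:
  assumes q: "q \<in> sylvester_loc n" and d: "d dvd sylvester n"
  shows "q / of_int d ^ k \<in> sylvester_loc n"
proof -
  obtain m where m: "q * of_int (sylvester n) ^ m \<in> \<int>"
    using q by (auto simp: sylvester_loc_def)
  obtain t where t: "sylvester n = d * t"
    using d by (elim dvdE)
  then have "d \<noteq> 0"
    using sylvester_pos[of n] by auto
  have "q / of_int d ^ k * of_int (sylvester n) ^ (m + k)
      = q * of_int (sylvester n) ^ m * (of_int (d * t) ^ k / of_int d ^ k)"
    by (simp add: power_add t)
  also have "\<dots> = q * of_int (sylvester n) ^ m * of_int (t ^ k)"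
    using \<open>d \<noteq> 0\<close> by (simp add: power_mult_distrib)
  finally have "q / of_int d ^ k * of_int (sylvester n) ^ (m + k) \<in> \<int>"
    using m by (simp only: Ints_mult Ints_of_int)
  then show ?thesis
    unfolding sylvester_loc_def by blast
qed

text \<open>With denominators cleared, coprimality of \<open>P\<close> and \<open>P + 1\<close>
  would force every power of \<open>P + 1\<close> to divide one fixed nonzero integer
  \<open>a\<close>.\<close>

lemma sylvester_loc_not_divisible:
  assumes "\<And>k. \<exists>y\<in>sylvester_loc n. q = of_int (sylvester n + 1) ^ k * y"
  shows "q = 0"
proof (rule ccontr)
  assume "q \<noteq> 0"
  define P where "P = sylvester n"
  have P: "P > 0"
    by (simp add: P_def sylvester_pos)
  have "q \<in> sylvester_loc n"
    using assms[of 0] by simp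
  then obtain m a where a: "q * of_int P ^ m = of_int a"
    by (auto simp: sylvester_loc_def P_def elim: Ints_cases)
  then have "a \<noteq> 0"
    using \<open>q \<noteq> 0\<close> P by auto
  \<comment> \<open>This exponent is already too large, as
    \<open>|a| < 2 ^ |a| \<le> (P + 1) ^ |a|\<close>.\<close>
  define k where "k = nat \<bar>a\<bar>"
  obtain y where y: "y \<in> sylvester_loc n" "q = of_int (P + 1) ^ k * y"
    using assms[of k] by (auto simp: P_def)
  then obtain l b where b: "y * of_int P ^ l = of_int b"
    by (auto simp: sylvester_loc_def P_def elim: Ints_cases)
  have "of_int (a * P ^ l) = q * of_int P ^ m * of_int P ^ l"
    by (simp add: a)
  also have "\<dots> = of_int ((P + 1) ^ k * (P ^ m * b))"
    by (simp add: y(2) flip: b)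
  finally have "a * P ^ l = (P + 1) ^ k * (P ^ m * b)"
    by (simp only: of_int_eq_iff)
  then have "(P + 1) ^ k dvd a * P ^ l"
    by simp
  moreover have "coprime ((P + 1) ^ k) (P ^ l)"
    by simp
  ultimately have "(P + 1) ^ k dvd a"
    by (simp add: coprime_dvd_mult_left_iff)
  with \<open>a \<noteq> 0\<close> have "\<bar>(P + 1) ^ k\<bar> \<le> \<bar>a\<bar>"
    by (rule dvd_imp_le_int)
  then have "(P + 1) ^ k \<le> \<bar>a\<bar>"
    by linarith
  moreover have "int k < 2 ^ k"
    by (metis of_nat_less_two_power)
  moreover have "(2::int) ^ k \<le> (P + 1) ^ k"
    using P by (intro power_mono) auto
  ultimately show False
    by (simp add: k_def)
qed

section \<open>Endomorphisms of the example are triangular, and the surjective ones are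
  injective\<close>

interpretation syl: rat_subgroups sylvester_loc
proof
  show "- a \<in> sylvester_loc n" if "a \<in> sylvester_loc n" for a n
    using that by (auto simp: sylvester_loc_def)
qed (auto simp: Ints_sylvester_loc add_sylvester_loc)

lemma one_sylvester_loc: "1 \<in> sylvester_loc n"
  by (simp add: Ints_sylvester_loc)

text \<open>The tail from \<open>n\<close> on consists of the elements divisible by all powers of
  \<open>sylvester j + 1\<close> for all \<open>j < n\<close>, so it is fully invariant.\<close>

lemma hom_preserves_tail:
  assumes f: "f \<in> hom syl.G syl.G" and x: "x \<in> carrier syl.G" "\<And>i. i < n \<Longrightarrow> x i = 0" and "j < n"
  shows "f x j = 0"
proof (rule sylvester_loc_not_divisible)
  fix k
  let ?d = "sylvester j + 1"
  define y where "y = (\<lambda>i. x i / of_int ?d ^ k)"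
  have d: "?d > 0"
    using sylvester_pos[of j] by simp
  \<comment> \<open>Below \<open>n\<close> the coordinate is 0. From \<open>n\<close> on,
    \<open>j < n \<le> i\<close>, so \<open>sylvester j + 1\<close> divides
    \<open>sylvester i\<close> and is invertible there.\<close>
  have "x i / of_int ?d ^ k \<in> sylvester_loc i" for i
  proof (cases "i < n")
    case True
    then show ?thesis
      using x by (simp add: syl.zero_mem)
  next
    case False
    then show ?thesis
      using x \<open>j < n\<close> by (intro divide_power_sylvester_loc Suc_sylvester_dvd) (auto simp: syl.mem_G)
  qed
  then have y: "y \<in> carrier syl.G"
    using x d by (simp add: syl.mem_G y_def)
  have "x = (\<lambda>i. of_int (?d ^ k) * y i)"
    using d by (simp add: y_def fun_eq_iff flip: of_int_add)
  then have "f x = (\<lambda>i. of_int (?d ^ k) * f y i)"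
    using syl.hom_scale[OF f y] by metis
  moreover have "f y j \<in> sylvester_loc j"
    using hom_in_carrier[OF f y] by (simp add: syl.mem_G)
  ultimately show "\<exists>z\<in>sylvester_loc j. f x j = of_int ?d ^ k * z"
    by auto
qed

text \<open>A surjective endomorphism acts by a nonzero scalar on each quotient of consecutive tails.
  The induction avoids naming the scalar by combining a preimage \<open>y\<close> of the \<open>n\<close>-th unit vector
  with \<open>x\<close> so that the \<open>n\<close>-th coordinate cancels.\<close>

lemma surj_hom_reflects_tail:
  assumes f: "f \<in> hom syl.G syl.G" and surj: "f ` carrier syl.G = carrier syl.G"
    and x: "x \<in> carrier syl.G" "\<And>i. i < n \<Longrightarrow> f x i = 0" and "i < n"
  shows "x i = 0"
  using x \<open>i < n\<close>
proof (induction n arbitrary: x i)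
  case (Suc n)
  have x_tail: "x i = 0" if "i < n" for i
    using Suc.IH Suc.prems(1,2) that by simp
  have "x n = 0"
  proof (rule ccontr)
    assume "x n \<noteq> 0"
    let ?e = "\<lambda>i. if i = n then 1 else 0 :: rat"
    have "?e \<in> f ` carrier syl.G"
      using surj one_sylvester_loc by (simp add: syl.unit_closed)
    then obtain y where y: "y \<in> carrier syl.G" "?e = f y"
      by (rule imageE)
    \<comment> \<open>The image of \<open>y\<close> is a unit vector, which vanishes below
      \<open>n\<close>, so the induction hypothesis applies to \<open>y\<close> as well as to
      \<open>x\<close>.\<close>
    have y_tail: "y i = 0" if "i < n" for i
      using Suc.IH[OF y(1)] y(2)[symmetric] that by simp
    obtain a b where ab: "b > 0" "x n = of_int a / of_int b"
      by (metis quotient_of_div quotient_of_denom_pos surj_pair)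
    obtain a' b' where ab': "b' > 0" "y n = of_int a' / of_int b'"
      by (metis quotient_of_div quotient_of_denom_pos surj_pair)
    \<comment> \<open>Cross-multiplying the fractions \<open>x n\<close> and \<open>y n\<close>
      gives integer coefficients that cancel coordinate \<open>n\<close>; \<open>c\<close> is
      nonzero because \<open>x n\<close> is.\<close>
    define c d where "c = b' * a" and "d = - (b * a')"
    have "c \<noteq> 0"
      using ab ab' \<open>x n \<noteq> 0\<close> by (auto simp: c_def)
    have cancel: "of_int c * y n + of_int d * x n = 0"
      using ab ab' by (simp add: c_def d_def)
    define z where "z = (\<lambda>i. of_int c * y i + of_int d * x i)"
    have scaled: "(\<lambda>i. of_int c * y i) \<in> carrier syl.G" "(\<lambda>i. of_int d * x i) \<in> carrier syl.G"
      using y Suc.prems by (auto intro: syl.scale_closed)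
    have "z \<in> carrier syl.G"
      unfolding z_def using scaled by (rule syl.add_closed)
    moreover have "z i = 0" if "i < Suc n" for i
      using that cancel x_tail y_tail by (cases "i = n") (auto simp: z_def)
    ultimately have "f z n = 0"
      using hom_preserves_tail[OF f] by blast
    moreover have "f z = (\<lambda>i. of_int c * f y i + of_int d * f x i)"
      using hom_mult[OF f scaled] syl.hom_scale[OF f] y(1) Suc.prems(1)
      by (simp add: syl.mult_G z_def)
    \<comment> \<open>Coordinate \<open>n\<close> of \<open>f z\<close> is 0 by triangularity, since
      \<open>z\<close> vanishes up to and including \<open>n\<close>. It also equals
      \<open>c * 1 + d * 0 = c\<close>.\<close>
    ultimately show False
      using \<open>c \<noteq> 0\<close> y(2)[symmetric] Suc.prems(2)[of n] by simp
  qed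
  then show ?case
    using x_tail Suc.prems(3) less_Suc_eq by blast
qed simp

lemma Dedekind_finite_syl: "Dedekind_finite syl.G"
proof (rule syl.Hopfian_imp_Dedekind_finite)
  fix f assume f: "f \<in> hom syl.G syl.G" and surj: "f ` carrier syl.G = carrier syl.G"
  interpret group_hom syl.G syl.G f
    using f by unfold_locales
  \<comment> \<open>The image of a kernel element vanishes in every coordinate, so the reflection
    lemma is available for every bound \<open>n\<close>.\<close>
  have "x = \<one>\<^bsub>syl.G\<^esub>" if "x \<in> carrier syl.G" "f x = \<one>\<^bsub>syl.G\<^esub>" for x
    using surj_hom_reflects_tail[OF f surj that(1)] that(2) by (auto simp: syl.one_G fun_eq_iff)
  then show "inj_on f (carrier syl.G)"
    by (simp add: inj_on_one_iff)
qed

section \<open>The shift embeds the group into a proper summand\<close>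

lemma not_Bassian_finite_syl: "\<not> Bassian_finite syl.G"
proof -
  define H where "H = {x \<in> carrier syl.G. x 0 = 0}"
  have H: "subgroup H syl.G"
  proof (rule syl.subgroupI)
    have "(\<lambda>_. 0) \<in> carrier syl.G"
      by (simp add: syl.mem_G syl.zero_mem)
    then show "H \<noteq> {}"
      by (auto simp: H_def)
    show "inv\<^bsub>syl.G\<^esub> x \<in> H" if "x \<in> H" for x
      using that syl.minus_closed[of x] by (simp add: H_def syl.inv_coord)
    show "x \<otimes>\<^bsub>syl.G\<^esub> y \<in> H" if "x \<in> H" "y \<in> H" for x y
      using that syl.add_closed[of x y] by (simp add: H_def syl.mult_G)
  qed (simp add: H_def)
  have sum: "H <#>\<^bsub>syl.G\<^esub> syl.line 0 = carrier syl.G"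
  proof (intro equalityI subsetI)
    fix x assume "x \<in> H <#>\<^bsub>syl.G\<^esub> syl.line 0"
    then show "x \<in> carrier syl.G"
      by (force simp: set_mult_def H_def syl.line_def)
  next
    fix x assume x: "x \<in> carrier syl.G"
    have "finite {i. (x(0 := 0)) i \<noteq> 0}"
      using x by (auto simp: syl.mem_G elim: rev_finite_subset)
    then have h: "x(0 := 0) \<in> H"
      using x by (simp add: H_def syl.mem_G syl.zero_mem)
    have l: "(\<lambda>i. if i = 0 then x 0 else 0) \<in> syl.line 0"
      using x by (intro syl.unit_mem_line) (simp add: syl.mem_G)
    have "x(0 := 0) \<otimes>\<^bsub>syl.G\<^esub> (\<lambda>i. if i = 0 then x 0 else 0) \<in> H <#>\<^bsub>syl.G\<^esub> syl.line 0"
      unfolding set_mult_def using h l by blast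
    moreover have "x(0 := 0) \<otimes>\<^bsub>syl.G\<^esub> (\<lambda>i. if i = 0 then x 0 else 0) = x"
      by (auto simp: syl.mult_G)
    ultimately show "x \<in> H <#>\<^bsub>syl.G\<^esub> syl.line 0"
      by simp
  qed
  have "x = \<one>\<^bsub>syl.G\<^esub>" if "x \<in> H \<inter> syl.line 0" for x
  proof
    fix i
    show "x i = \<one>\<^bsub>syl.G\<^esub> i"
      using that by (cases "i = 0") (auto simp: H_def syl.line_def syl.one_G)
  qed
  then have "H \<inter> syl.line 0 = {\<one>\<^bsub>syl.G\<^esub>}"
    using H syl.line_subgroup[of 0] by (auto dest: subgroup.one_closed)
  then have "direct_summand H syl.G"
    using H sum syl.line_subgroup[of 0] by (auto simp: direct_summand_def)
  moreover have "(\<lambda>i. if i = 0 then 1 else 0) \<notin> H"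
    by (simp add: H_def)
  then have "H \<noteq> carrier syl.G"
    using syl.unit_closed[OF one_sylvester_loc, of 0] by metis
  \<comment> \<open>The right shift: coordinate 0 becomes 0 and \<open>x i\<close> moves to position
    \<open>i + 1\<close>.\<close>
  moreover define s where "s = (\<lambda>x :: nat \<Rightarrow> rat. case_nat 0 x)"
  have "s \<in> mon syl.G (syl.G\<lparr>carrier := H\<rparr>)"
  proof -
    have "s x \<in> H" if "x \<in> carrier syl.G" for x
    proof -
      have "{i. s x i \<noteq> 0} \<subseteq> Suc ` {i. x i \<noteq> 0}"
      proof
        fix i assume "i \<in> {i. s x i \<noteq> 0}"
        then show "i \<in> Suc ` {i. x i \<noteq> 0}"
          by (cases i) (auto simp: s_def)
      qed
      moreover have "finite (Suc ` {i. x i \<noteq> 0})"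
        using that by (simp add: syl.mem_G)
      ultimately have "finite {i. s x i \<noteq> 0}"
        by (rule finite_subset)
      \<comment> \<open>At a successor \<open>i\<close> the value is \<open>x (i - 1)\<close>, which
        lies in the smaller ring with index \<open>i - 1\<close>; at \<open>i = 0\<close> it is
        0.\<close>
      moreover have "s x i \<in> sylvester_loc i" for i
        using that sylvester_loc_mono[of "i - 1" i]
        by (cases i) (auto simp: s_def syl.mem_G syl.zero_mem)
      ultimately show ?thesis
        by (simp add: H_def syl.mem_G) (simp add: s_def)
    qed
    moreover have "s (x \<otimes>\<^bsub>syl.G\<^esub> y) = s x \<otimes>\<^bsub>syl.G\<^esub> s y" for x y
      by (simp add: s_def syl.mult_G fun_eq_iff split: nat.split)
    moreover have "inj s"
    proof (rule injI)
      fix x y assume "s x = s y"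
      then have "s x (Suc i) = s y (Suc i)" for i
        by simp
      then show "x = y"
        by (auto simp: s_def)
    qed
    ultimately show ?thesis
      by (simp add: mon_def hom_def inj_on_subset[of s UNIV])
  qed
  ultimately show ?thesis
    unfolding Bassian_finite_def by blast
qed

theorem mainTheorem4:
  shows "\<exists>G :: (nat \<Rightarrow> rat) monoid.
    comm_group G \<and> torsion_free G \<and> completely_decomposable G \<and>
    Dedekind_finite G \<and> \<not> Bassian_finite G"
  using syl.comm_group_axioms syl.torsion_free_G syl.completely_decomposable_G[OF one_sylvester_loc]
    Dedekind_finite_syl not_Bassian_finite_syl
  by blast

end
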